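(* Let $n \ge k \ge 3$ be integers such that $\frac{(n-2)!}{k!(n-k)!} \in \mathbb{Z}$. Then \[ \sum_{U \subseteq \binom{[n]}{k}} \prod_{e \in \binom{[n]}{2}} \cos\!\left( \frac{2\pi}{k(k-1)} \cdot \mathrm{mult}(e,U) \right) = 0 \] if and only if $n \ge R(k)$.
   Context: $[n]=\{1,\dots,n\}$; $\binom{S}{j}$ denotes the set of $j$-element subsets of a set $S$. For $U \subseteq \binom{[n]}{k}$ and $e \in \binom{[n]}{2}$, $\mathrm{mult}(e,U) := \#\{S \in U : e \subseteq S\}$. The $k$-th diagonal Ramsey number $R(k)$ is the least positive integer $n$ such that every (finite simple undirected) graph on $n$ vertices contains a clique of size $k$ or an independent set of size $k$. *)

theory Defs
  imports Complex_Main "HOL-Library.Ramsey"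
begin

definition mult :: "'a set \<Rightarrow> 'a set set \<Rightarrow> nat" where
  "mult e U = card {S \<in> U. e \<subseteq> S}"

text \<open>A simple graph on a vertex set \<open>V\<close> is given by its edge set, a set of two-element subsets
  of \<open>V\<close>. It suffices to let \<open>V\<close> range over sets of natural numbers, since every
  finite graph is isomorphic to one of these.\<close>

definition ramsey_property :: "nat \<Rightarrow> nat \<Rightarrow> bool" where
  "ramsey_property k n \<longleftrightarrow>
     (\<forall>(V :: nat set) E. finite V \<and> card V = n \<and> E \<subseteq> nsets V 2 \<longrightarrow>
        (\<exists>W \<subseteq> V. card W = k \<and> (clique W E \<or> indep W E)))"

definition diag_ramsey :: "nat \<Rightarrow> nat" where
  "diag_ramsey k = (LEAST n. 0 < n \<and> ramsey_property k n)"

lemma ramsey_property_exists: "\<exists>n. 0 < n \<and> ramsey_property k n"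
proof -
  obtain r :: nat where r: "r \<ge> 1"
    and P: "\<forall>(V :: nat set) E. finite V \<and> card V \<ge> r \<longrightarrow>
      (\<exists>R \<subseteq> V. card R = k \<and> clique R E \<or> card R = k \<and> indep R E)"
    using ramsey2[of k k] by blast
  have "ramsey_property k r"
    unfolding ramsey_property_def
  proof (intro allI impI)
    fix V :: "nat set" and E
    assume "finite V \<and> card V = r \<and> E \<subseteq> nsets V 2"
    then have "finite V \<and> card V \<ge> r" by simp
    with P show "\<exists>W \<subseteq> V. card W = k \<and> (clique W E \<or> indep W E)" by metis
  qed
  with r show ?thesis by (intro exI[of _ r]) simp
qed

lemma diag_ramsey: "0 < diag_ramsey k" "ramsey_property k (diag_ramsey k)"
  using LeastI_ex[OF ramsey_property_exists[of k]] by (simp_all add: diag_ramsey_def)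

end

theory Submission
  imports Defs
begin

text \<open>
  Write each cosine as \<open>(cis x + cis (- x)) / 2\<close> and expand the product over the edges: this is a sum
  over all 2-colourings of the edges, that is, over all graphs. Interchanging the two sums, the sum
  over \<open>U\<close> factors into \<open>\<Prod>\<^sub>S (1 + cis x\<^sub>S)\<close>, where \<open>x\<^sub>S\<close> is \<open>\<pi>\<close> times the normalised colour imbalance
  of the \<open>k\<close>-set \<open>S\<close>. Since \<open>1 + cis x = 2 cos (x/2) cis (x/2)\<close> and \<open>\<bar>x\<^sub>S\<bar> \<le> \<pi>\<close>, each factor is a
  nonnegative number, zero exactly if \<open>S\<close> is monochromatic, times a phase. The divisibility
  hypothesis makes the total phase the same for all colourings, so nothing cancels, and the sum
  vanishes exactly if every graph has a monochromatic \<open>k\<close>-set.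
\<close>

section \<open>Expansion over the 2-colourings of the edges\<close>

text \<open>Reads the graph \<open>A\<close> as a 2-colouring, so that summing over a set of edges
  gives its signed colour imbalance.\<close>

definition edge_sign :: "'a set set \<Rightarrow> 'a set \<Rightarrow> real" where
  "edge_sign A e = (if e \<in> A then 1 else - 1)"

lemma cis_sum: "finite I \<Longrightarrow> cis (sum f I) = (\<Prod>i\<in>I. cis (f i))"
  by (induction I rule: finite_induct) (simp_all flip: cis_mult)

text \<open>Half-angle formulas separate a real amplitude from a phase. The amplitude can be
  negative in general; \<open>cos_edge_imbalance\<close> settles its sign for the angles that
  occur.\<close>

lemma one_plus_cis: "1 + cis x = of_real (2 * cos (x / 2)) * cis (x / 2)"
proof -
  have "cos x = 2 * (cos (x / 2))\<^sup>2 - 1" and "sin x = 2 * sin (x / 2) * cos (x / 2)"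
    using cos_double_cos[of "x / 2"] sin_double[of "x / 2"] by simp_all
  then show ?thesis
    by (simp add: complex_eq_iff power2_eq_square)
qed

text \<open>Each factor is \<open>(cis x + cis (- x)) / 2\<close>; in the expanded product,
  \<open>A\<close> records the edges at which the summand \<open>cis x\<close> is chosen.\<close>

lemma prod_cos_expand:
  assumes "finite E"
  shows "complex_of_real (\<Prod>e\<in>E. cos (f e)) =
    (\<Sum>A\<in>Pow E. cis (\<Sum>e\<in>E. edge_sign A e * f e)) / 2 ^ card E"
proof -
  have "complex_of_real (cos x) = (cis x + cis (- x)) / 2" for x
    by (simp add: complex_eq_iff)
  then have "complex_of_real (\<Prod>e\<in>E. cos (f e)) = (\<Prod>e\<in>E. cis (f e) + cis (- f e)) / 2 ^ card E"
    by (simp only: of_real_prod prod_dividef prod_constant)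
  also have "(\<Prod>e\<in>E. cis (f e) + cis (- f e)) =
      (\<Sum>A\<in>Pow E. (\<Prod>e\<in>A. cis (f e)) * (\<Prod>e\<in>E - A. cis (- f e)))"
    by (rule prod_add[OF assms])
  also have "\<dots> = (\<Sum>A\<in>Pow E. cis (\<Sum>e\<in>E. edge_sign A e * f e))"
  proof (rule sum.cong[OF refl])
    fix A assume "A \<in> Pow E"
    then have A: "A \<subseteq> E" by simp
    have "cis (\<Sum>e\<in>E. edge_sign A e * f e) = (\<Prod>e\<in>E. cis (edge_sign A e * f e))"
      by (rule cis_sum[OF assms])
    also have "\<dots> = (\<Prod>e\<in>E - A. cis (edge_sign A e * f e)) * (\<Prod>e\<in>A. cis (edge_sign A e * f e))"
      by (rule prod.subset_diff[OF A assms])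
    also have "\<dots> = (\<Prod>e\<in>A. cis (f e)) * (\<Prod>e\<in>E - A. cis (- f e))"
      by (simp add: edge_sign_def mult.commute)
    finally show "(\<Prod>e\<in>A. cis (f e)) * (\<Prod>e\<in>E - A. cis (- f e)) =
      cis (\<Sum>e\<in>E. edge_sign A e * f e)" ..
  qed
  finally show ?thesis .
qed

text \<open>Double counting of the pairs of an edge and a member of \<open>U\<close> containing
  it.\<close>

lemma sum_mult_swap:
  assumes "finite E" "finite U"
  shows "(\<Sum>e\<in>E. g e * real (mult e U)) = (\<Sum>S\<in>U. \<Sum>e | e \<in> E \<and> e \<subseteq> S. g e)"
proof -
  have "(\<Sum>e\<in>E. g e * real (mult e U)) = (\<Sum>e\<in>E. \<Sum>S | S \<in> U \<and> e \<subseteq> S. g e)"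
    by (simp add: mult_def mult.commute)
  also have "\<dots> = (\<Sum>S\<in>U. \<Sum>e | e \<in> E \<and> e \<subseteq> S. g e)"
    by (rule sum.swap_restrict[OF assms])
  finally show ?thesis .
qed

text \<open>For a fixed colouring the phase is additive over the members of \<open>U\<close>. After
  interchanging the sums, the sum over \<open>U\<close> is therefore the expansion of a product in
  which each \<open>S\<close> is either chosen, giving a \<open>cis\<close> factor, or left out,
  giving 1.\<close>

lemma sum_Pow_prod_cos:
  assumes "finite E" "finite K"
  shows "complex_of_real (\<Sum>U\<in>Pow K. \<Prod>e\<in>E. cos (t * real (mult e U))) =
    (\<Sum>A\<in>Pow E. \<Prod>S\<in>K. 1 + cis (t * (\<Sum>e | e \<in> E \<and> e \<subseteq> S. edge_sign A e))) / 2 ^ card E"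
proof -
  define s where "s A S = t * (\<Sum>e | e \<in> E \<and> e \<subseteq> S. edge_sign A e)" for A S
  have phase: "(\<Sum>e\<in>E. edge_sign A e * (t * real (mult e U))) = (\<Sum>S\<in>U. s A S)" if "U \<subseteq> K" for A U
  proof -
    have "finite U" using that assms(2) by (rule finite_subset)
    from sum_mult_swap[OF assms(1) this, of "\<lambda>e. t * edge_sign A e"] show ?thesis
      by (simp add: s_def sum_distrib_left mult_ac)
  qed
  have "complex_of_real (\<Sum>U\<in>Pow K. \<Prod>e\<in>E. cos (t * real (mult e U))) =
      (\<Sum>U\<in>Pow K. (\<Sum>A\<in>Pow E. cis (\<Sum>S\<in>U. s A S)) / 2 ^ card E)"
    unfolding of_real_sum
    by (rule sum.cong[OF refl]) (simp only: prod_cos_expand[OF assms(1)] Pow_iff phase)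
  also have "\<dots> = (\<Sum>A\<in>Pow E. \<Sum>U\<in>Pow K. cis (\<Sum>S\<in>U. s A S)) / 2 ^ card E"
    unfolding sum_divide_distrib[symmetric] by (simp only: sum.swap[of _ "Pow K"])
  also have "(\<Sum>A\<in>Pow E. \<Sum>U\<in>Pow K. cis (\<Sum>S\<in>U. s A S)) = (\<Sum>A\<in>Pow E. \<Prod>S\<in>K. 1 + cis (s A S))"
  proof (rule sum.cong[OF refl])
    fix A
    have "(\<Prod>S\<in>K. cis (s A S) + 1) = (\<Sum>U\<in>Pow K. (\<Prod>S\<in>U. cis (s A S)) * (\<Prod>S\<in>K - U. 1))"
      by (rule prod_add[OF assms(2)])
    also have "\<dots> = (\<Sum>U\<in>Pow K. cis (\<Sum>S\<in>U. s A S))"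
      using finite_subset[OF _ assms(2)] by (intro sum.cong refl) (simp add: cis_sum)
    finally show "(\<Sum>U\<in>Pow K. cis (\<Sum>S\<in>U. s A S)) = (\<Prod>S\<in>K. 1 + cis (s A S))"
      by (simp add: add.commute)
  qed
  finally show ?thesis by (simp add: s_def)
qed

section \<open>Edge multiplicities and colour imbalance\<close>

text \<open>Deleting \<open>e\<close> is a bijection from the sets counted onto subsets of
  \<open>V - e\<close>. The value depends on \<open>e\<close> only through its size, which is why
  all edges will contribute the same phase up to sign.\<close>

lemma mult_nsets:
  assumes "finite V" "e \<subseteq> V" "card e \<le> k"
  shows "mult e (nsets V k) = (card V - card e) choose (k - card e)"
proof -
  have e: "finite e" using assms(1,2) finite_subset by blast
  have "bij_betw (\<lambda>T. T \<union> e) {T. T \<subseteq> V - e \<and> card T = k - card e} {S \<in> nsets V k. e \<subseteq> S}"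
  proof (rule bij_betw_byWitness[where f' = "\<lambda>S. S - e"])
    show "(\<lambda>T. T \<union> e) ` {T. T \<subseteq> V - e \<and> card T = k - card e} \<subseteq> {S \<in> nsets V k. e \<subseteq> S}"
    proof safe
      fix T assume T: "T \<subseteq> V - e" "card T = k - card e"
      then have "finite T" using assms(1) finite_subset by blast
      then have "card (T \<union> e) = k"
        using T e assms(3) by (subst card_Un_disjoint) auto
      then show "T \<union> e \<in> nsets V k"
        using T assms(2) e \<open>finite T\<close> by (auto simp: nsets_def)
    qed
    show "(\<lambda>S. S - e) ` {S \<in> nsets V k. e \<subseteq> S} \<subseteq> {T. T \<subseteq> V - e \<and> card T = k - card e}"
      using e by (auto simp: nsets_def card_Diff_subset)
  qed auto
  then have "mult e (nsets V k) = card {T. T \<subseteq> V - e \<and> card T = k - card e}"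
    unfolding mult_def by (rule bij_betw_same_card[symmetric])
  also have "\<dots> = (card V - card e) choose (k - card e)"
    using assms e by (simp add: n_subsets card_Diff_subset)
  finally show ?thesis .
qed

lemma sum_edge_sign:
  assumes "finite F"
  shows "(\<Sum>e\<in>F. edge_sign A e) = 2 * real (card (F \<inter> A)) - real (card F)"
proof -
  have "(\<Sum>e\<in>F. edge_sign A e) = real (card (F \<inter> A)) - real (card (F - A))"
    using assms by (simp add: edge_sign_def sum.If_cases Diff_eq)
  then show ?thesis
    using card_Int_Diff[OF assms, of A] by simp
qed

text \<open>If \<open>m\<close> of the \<open>N\<close> edges lie in \<open>A\<close>, the imbalance
  is \<open>2 * m - N\<close> and the angle is \<open>pi * (m / N) - pi / 2\<close>. The cosine is
  thus the sine of an angle between 0 and \<open>pi\<close>, vanishing only at the two ends, where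
  \<open>F\<close> is monochromatic.\<close>

lemma cos_edge_imbalance:
  fixes A F :: "'a set set"
  assumes "finite F" "F \<noteq> {}"
  defines "c \<equiv> cos (pi / (2 * real (card F)) * (\<Sum>e\<in>F. edge_sign A e))"
  shows "0 \<le> c" and "c = 0 \<longleftrightarrow> F \<subseteq> A \<or> F \<inter> A = {}"
proof -
  define N m where "N = real (card F)" and "m = real (card (F \<inter> A))"
  have N: "N > 0" using assms by (simp add: N_def card_gt_0_iff)
  have m: "0 \<le> m" "m \<le> N"
    using assms by (auto simp: N_def m_def intro: card_mono)
  have "c = cos (pi * (m / N) - pi / 2)"
    unfolding c_def sum_edge_sign[OF assms(1)] N_def[symmetric] m_def[symmetric]
    using N by (intro arg_cong[of _ _ cos]) (simp add: field_simps)
  then have c: "c = sin (pi * (m / N))" by (simp add: cos_diff)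
  have "pi * (m / N) \<le> pi * 1" using m N by (intro mult_left_mono) auto
  then show "0 \<le> c" unfolding c using m N by (intro sin_ge_zero) auto
  have "m = 0 \<longleftrightarrow> F \<inter> A = {}" using assms by (simp add: m_def)
  moreover have "m = N \<longleftrightarrow> F \<subseteq> A"
    using card_subset_eq[OF assms(1), of "F \<inter> A"] by (auto simp: m_def N_def Int_absorb2)
  moreover have "c = 0 \<longleftrightarrow> m = 0 \<or> m = N"
  proof
    assume "m = 0 \<or> m = N"
    then show "c = 0" using N by (auto simp: c)
  next
    assume 0: "c = 0"
    show "m = 0 \<or> m = N"
    proof (rule ccontr)
      assume "\<not> ?thesis"
      then have "0 < m / N" "m / N < 1" using m N by auto
      then have "0 < pi * (m / N)" "pi * (m / N) < pi * 1"
        by (intro mult_pos_pos mult_strict_left_mono; simp)+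
      then have "c > 0" unfolding c by (intro sin_gt_zero) auto
      with 0 show False by simp
    qed
  qed
  ultimately show "c = 0 \<longleftrightarrow> F \<subseteq> A \<or> F \<inter> A = {}" by blast
qed

section \<open>Ramsey property: monotonicity and reduction to a fixed vertex set\<close>

lemma clique_iff_nsets: "clique S A \<longleftrightarrow> nsets S 2 \<subseteq> A"
  unfolding clique_def nsets_2_eq by auto

lemma indep_iff_nsets: "indep S A \<longleftrightarrow> nsets S 2 \<inter> A = {}"
  unfolding indep_def nsets_2_eq by auto

lemma ramsey_property_mono:
  assumes "ramsey_property k m" "m \<le> n"
  shows "ramsey_property k n"
  unfolding ramsey_property_def
proof (intro allI impI)
  fix V :: "nat set" and E
  assume V: "finite V \<and> card V = n \<and> E \<subseteq> nsets V 2"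
  then obtain V' where V': "V' \<subseteq> V" "card V' = m" "finite V'"
    using assms(2) by (metis obtain_subset_with_card_n)
  \<comment> \<open>The property for \<open>m\<close> only speaks of graphs whose edges lie within
    \<open>V'\<close>, hence the restriction of \<open>E\<close>.\<close>
  then obtain W where W: "W \<subseteq> V'" "card W = k"
    and m: "clique W (E \<inter> nsets V' 2) \<or> indep W (E \<inter> nsets V' 2)"
    using assms(1) unfolding ramsey_property_def by (metis Int_lower2)
  have "nsets W 2 \<subseteq> nsets V' 2" using W by (intro nsets_mono)
  then have "clique W E \<or> indep W E"
    using m unfolding clique_iff_nsets indep_iff_nsets by blast
  then show "\<exists>W\<subseteq>V. card W = k \<and> (clique W E \<or> indep W E)"
    using W V' by blast
qed

lemma diag_ramsey_le_iff:
  assumes "0 < n"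
  shows "diag_ramsey k \<le> n \<longleftrightarrow> ramsey_property k n"
proof
  assume "diag_ramsey k \<le> n"
  with diag_ramsey(2) show "ramsey_property k n" by (rule ramsey_property_mono)
next
  assume "ramsey_property k n"
  with assms show "diag_ramsey k \<le> n" unfolding diag_ramsey_def by (intro Least_le) simp
qed

text \<open>The property is invariant under relabelling vertices, so the single vertex set over
  which the theorem sums is enough.\<close>

lemma ramsey_property_iff_interval:
  "ramsey_property k n \<longleftrightarrow>
    (\<forall>A \<subseteq> nsets {1..n} 2. \<exists>W \<subseteq> {1..n}. card W = k \<and> (clique W A \<or> indep W A))"
proof
  assume "ramsey_property k n"
  then show "\<forall>A \<subseteq> nsets {1..n} 2. \<exists>W \<subseteq> {1..n}. card W = k \<and> (clique W A \<or> indep W A)"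
    unfolding ramsey_property_def by simp
next
  assume *: "\<forall>A \<subseteq> nsets {1..n} 2. \<exists>W \<subseteq> {1..n}. card W = k \<and> (clique W A \<or> indep W A)"
  show "ramsey_property k n"
    unfolding ramsey_property_def
  proof (intro allI impI)
    fix V :: "nat set" and E
    assume V: "finite V \<and> card V = n \<and> E \<subseteq> nsets V 2"
    then obtain h where h: "bij_betw h {1..n} V"
      using finite_same_card_bij[of "{1..n}" V] by auto
    \<comment> \<open>The graph \<open>E\<close> pulled back along the relabelling
      \<open>h\<close>.\<close>
    define A where "A = {e \<in> nsets {1..n} 2. h ` e \<in> E}"
    have "A \<subseteq> nsets {1..n} 2" by (auto simp: A_def)
    with * obtain W where W: "W \<subseteq> {1..n}" "card W = k" and m: "clique W A \<or> indep W A"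
      by blast
    have inj: "inj_on h W" using h W(1) bij_betw_imp_inj_on inj_on_subset by blast
    \<comment> \<open>Distinct images force \<open>x\<close> and \<open>y\<close> to be distinct, so
      the pair is a genuine edge of the interval.\<close>
    have A: "{h x, h y} \<in> E \<longleftrightarrow> {x, y} \<in> A" if "x \<in> W" "y \<in> W" "h x \<noteq> h y" for x y
      using that W(1) by (auto simp: A_def)
    from m have "clique (h ` W) E \<or> indep (h ` W) E"
    proof
      assume "clique W A"
      then show ?thesis unfolding clique_def by (auto simp: A)
    next
      assume "indep W A"
      then show ?thesis unfolding indep_def by (auto simp: A)
    qed
    moreover have "h ` W \<subseteq> V" using h W(1) bij_betw_imp_surj_on by blast
    moreover have "card (h ` W) = k" using card_image[OF inj] W(2) by simp
    ultimately show "\<exists>W\<subseteq>V. card W = k \<and> (clique W E \<or> indep W E)" by blast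
  qed
qed

section \<open>The common phase and the vanishing criterion\<close>

theorem theorem2p1:
  fixes n k :: nat
  assumes "3 \<le> k" and "k \<le> n"
    and "fact (n - 2) / (fact k * fact (n - k)) \<in> (\<int> :: real set)"
  shows "(\<Sum>U \<in> Pow (nsets {1..n} k). \<Prod>e \<in> nsets {1..n} 2.
            cos (2 * pi / (real k * (real k - 1)) * real (mult e U))) = 0
         \<longleftrightarrow> n \<ge> diag_ramsey k"
proof -
  define E K where "E = nsets {1..n} 2" and "K = nsets {1..n} k"
  define t where "t = 2 * pi / (real k * (real k - 1))"
  define s where "s A S = (\<Sum>e | e \<in> E \<and> e \<subseteq> S. edge_sign A e)" for A S
  define M :: real where "M = fact (n - 2) / (fact k * fact (n - k))"
  define G where "G A = (\<Prod>S\<in>K. 2 * cos (t / 2 * s A S))" for A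
  have fin: "finite E" "finite K" by (simp_all add: E_def K_def finite_imp_finite_nsets)

  have edges: "{e. e \<in> E \<and> e \<subseteq> S} = nsets S 2" if "S \<in> K" for S
    using that by (auto simp: E_def K_def nsets_def)
  \<comment> \<open>Since \<open>t\<close> is \<open>pi\<close> divided by the number of edges in a
    \<open>k\<close>-set, \<open>t / 2 * s A S\<close> is exactly the angle treated in
    \<open>cos_edge_imbalance\<close>.\<close>
  have card_edges: "t / 2 = pi / (2 * real (card (nsets S 2)))" "nsets S 2 \<noteq> {}" "finite (nsets S 2)"
    if "S \<in> K" for S
  proof -
    have S: "finite S" "card S = k" using that by (auto simp: K_def nsets_def)
    then have "nsets S 2 = {e. e \<subseteq> S \<and> card e = 2}"
      using finite_subset by (auto simp: nsets_def)
    then have "card (nsets S 2) = k choose 2" using S by (simp add: n_subsets)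
    moreover have "real (k choose 2) = real k * (real k - 1) / 2"
      using assms(1) by (simp add: choose_two real_of_nat_div of_nat_diff)
    ultimately show "t / 2 = pi / (2 * real (card (nsets S 2)))" by (simp add: t_def)
    show "nsets S 2 \<noteq> {}" using S assms(1) by (simp add: nsets_eq_empty_iff)
    show "finite (nsets S 2)" using S(1) by (rule finite_imp_finite_nsets)
  qed

  \<comment> \<open>The multiplicity is \<open>(n - 2) choose (k - 2)\<close>; dividing by
    \<open>k * (k - 1)\<close> turns \<open>fact (k - 2)\<close> into \<open>fact k\<close> and
    yields the quotient in the hypothesis.\<close>
  have M: "t / 2 * real (mult e K) = pi * M" if "e \<in> E" for e
  proof -
    have e: "e \<subseteq> {1..n}" "card e = 2" using that by (auto simp: E_def nsets_def)
    define j where "j = k - 2"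
    then have j: "k = j + 2" using assms(1) by linarith
    have "mult e K = (n - 2) choose (k - 2)"
      using mult_nsets[of "{1..n}" e k] e assms(1) by (simp add: K_def)
    then have "real (mult e K) = fact (n - 2) / (fact (k - 2) * fact (n - k))"
      using assms(2) by (simp add: j binomial_fact)
    moreover have "(fact k :: real) = real k * (real k - 1) * fact (k - 2)"
      by (simp add: j algebra_simps)
    moreover have "t / 2 = pi / (real k * (real k - 1))"
      by (simp add: t_def)
    ultimately show ?thesis
      by (simp only: M_def times_divide_eq_right times_divide_eq_left divide_divide_eq_left mult_ac)
  qed
  have phase: "cis (t / 2 * (\<Sum>S\<in>K. s A S)) = cis (pi * M) ^ card E" for A
  proof -
    have "t / 2 * (\<Sum>S\<in>K. s A S) = (\<Sum>e\<in>E. edge_sign A e * (t / 2 * real (mult e K)))"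
      unfolding s_def sum_mult_swap[OF fin, symmetric] by (simp add: sum_distrib_left mult_ac)
    also have "\<dots> = (\<Sum>e\<in>E. edge_sign A e * (pi * M))"
      by (intro sum.cong refl) (simp only: M)
    finally have "cis (t / 2 * (\<Sum>S\<in>K. s A S)) = (\<Prod>e\<in>E. cis (edge_sign A e * (pi * M)))"
      by (simp only: cis_sum[OF fin(1)])
    \<comment> \<open>The integrality hypothesis enters here: the two angles differ by
      \<open>2 * pi * M\<close>, an integer multiple of a full turn. Hence the colour of an edge
      does not affect its phase.\<close>
    moreover have "cis (- (pi * M)) = cis (pi * M)"
    proof -
      have "cis (pi * M) = cis (- (pi * M)) * cis (2 * pi * M)"
        by (simp add: cis_mult mult.commute)
      then show ?thesis using cis_multiple_2pi[OF assms(3)] by (simp only: M_def mult_1_right)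
    qed
    then have "cis (edge_sign A e * (pi * M)) = cis (pi * M)" for e
      by (simp add: edge_sign_def)
    ultimately show ?thesis by simp
  qed

  have "(\<Prod>S\<in>K. 1 + cis (t * s A S)) = of_real (G A) * cis (pi * M) ^ card E" for A
  proof -
    have "(\<Prod>S\<in>K. 1 + cis (t * s A S)) =
        (\<Prod>S\<in>K. of_real (2 * cos (t / 2 * s A S)) * cis (t / 2 * s A S))"
      by (simp only: one_plus_cis times_divide_eq_left)
    also have "\<dots> = of_real (G A) * cis (\<Sum>S\<in>K. t / 2 * s A S)"
      unfolding G_def of_real_prod cis_sum[OF fin(2)] by (rule prod.distrib)
    finally show ?thesis by (simp only: phase sum_distrib_left[symmetric])
  qed
  then have "complex_of_real (\<Sum>U\<in>Pow K. \<Prod>e\<in>E. cos (t * real (mult e U))) =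
      of_real (\<Sum>A\<in>Pow E. G A) * cis (pi * M) ^ card E / 2 ^ card E"
    unfolding sum_Pow_prod_cos[OF fin] s_def[symmetric]
    by (simp add: sum_distrib_right)
  \<comment> \<open>The phase does not depend on \<open>A\<close> and is nonzero, so it can be
    cancelled, leaving a real sum of the amplitudes \<open>G A\<close>.\<close>
  then have "(\<Sum>U\<in>Pow K. \<Prod>e\<in>E. cos (t * real (mult e U))) = 0 \<longleftrightarrow> (\<Sum>A\<in>Pow E. G A) = 0"
    by (metis (no_types, lifting) cis_neq_zero divide_eq_0_iff mult_eq_0_iff of_real_eq_0_iff
        power_not_zero zero_neq_numeral)
  also have "\<dots> \<longleftrightarrow> (\<forall>A\<in>Pow E. G A = 0)"
  proof (rule sum_nonneg_eq_0_iff)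
    fix A
    have "0 \<le> cos (t / 2 * s A S)" if "S \<in> K" for S
      unfolding s_def edges[OF that] card_edges(1)[OF that]
      by (rule cos_edge_imbalance(1)) (use card_edges that in auto)
    then show "0 \<le> G A" unfolding G_def by (intro prod_nonneg) simp
  qed (use fin in simp)
  also have "\<dots> \<longleftrightarrow> (\<forall>A \<subseteq> E. \<exists>S\<in>K. clique S A \<or> indep S A)"
  proof -
    have "G A = 0 \<longleftrightarrow> (\<exists>S\<in>K. clique S A \<or> indep S A)" for A
    proof -
      have "cos (t / 2 * s A S) = 0 \<longleftrightarrow> clique S A \<or> indep S A" if "S \<in> K" for S
        unfolding s_def edges[OF that] card_edges(1)[OF that] clique_iff_nsets indep_iff_nsets
        by (rule cos_edge_imbalance(2)) (use card_edges that in auto)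
      then show ?thesis unfolding G_def using fin(2) by auto
    qed
    then show ?thesis by (simp only: Ball_def Pow_iff)
  qed
  also have "\<dots> \<longleftrightarrow> ramsey_property k n"
  proof -
    have "S \<in> K \<longleftrightarrow> S \<subseteq> {1..n} \<and> card S = k" for S
      using finite_subset[of S "{1..n}"] by (auto simp: K_def nsets_def)
    then show ?thesis unfolding ramsey_property_iff_interval E_def by (simp add: Bex_def conj_assoc)
  qed
  also have "\<dots> \<longleftrightarrow> n \<ge> diag_ramsey k"
    using diag_ramsey_le_iff[of n k] assms(1,2) by simp
  finally show ?thesis unfolding E_def K_def t_def .
qed

end
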